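(* Let $\mathcal{B}$ be an RKBS on a set $X$ having a pre-dual space $\mathcal{B}_*$, and let $\Delta:=\mathrm{span}\{\delta_x:x\in X\}\subseteq\mathcal{B}^*$. If $\Delta\subseteq\mathcal{B}_*$, then $\overline{\Delta}=\mathcal{B}_*$, where the closure is taken in the norm of $\mathcal{B}^*$.
   Context: A Banach space $\mathcal{B}$ is a Banach space of functions on $X$ if its elements are (real-valued) functions on $X$ and, for each $f\in\mathcal{B}$, $\|f\|_{\mathcal{B}}=0$ implies $f(x)=0$ for all $x\in X$. It is an RKBS (reproducing kernel Banach space) on $X$ if each point evaluation functional $\delta_x:f\mapsto f(x)$, $x\in X$, is continuous on $\mathcal{B}$. A pre-dual space of $\mathcal{B}$ is a Banach space $\mathcal{B}_*$ with $(\mathcal{B}_* )^*=\mathcal{B}$ (isometric identification); it is regarded as a subspace of $\mathcal{B}^*$ through the isometric embedding $\langle\nu,f\rangle_{\mathcal{B}}=\langle f,\nu\rangle_{\mathcal{B}_*}$ for $f\in\mathcal{B}$, $\nu\in\mathcal{B}_*$. *)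

theory Defs
  imports "HOL-Analysis.Analysis"
begin

text \<open>
  The Banach space is a type \<open>'b :: banach\<close>, so that its dual, with the operator norm, is
  \<open>'b \<Rightarrow>\<^sub>L real\<close>. That its elements are functions on \<open>X\<close> is expressed by a map \<open>ev\<close> sending
  \<open>f\<close> to the function \<open>\<lambda>x. ev f x\<close>; only the values on \<open>X\<close> matter. Injectivity of the
  restriction to \<open>X\<close> identifies elements of \<open>'b\<close> with functions on \<open>X\<close>, and the two linearity
  clauses say that the vector space operations are the pointwise ones.
\<close>

definition banach_space_of_functions :: "'x set \<Rightarrow> ('b::banach \<Rightarrow> 'x \<Rightarrow> real) \<Rightarrow> bool" where
  "banach_space_of_functions X ev \<longleftrightarrow>
     inj (\<lambda>f. restrict (ev f) X) \<and>
     (\<forall>f g. \<forall>x\<in>X. ev (f + g) x = ev f x + ev g x) \<and>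
     (\<forall>c f. \<forall>x\<in>X. ev (c *\<^sub>R f) x = c * ev f x) \<and>
     (\<forall>f. norm f = 0 \<longrightarrow> (\<forall>x\<in>X. ev f x = 0))"

definition rkbs :: "'x set \<Rightarrow> ('b::banach \<Rightarrow> 'x \<Rightarrow> real) \<Rightarrow> bool" where
  "rkbs X ev \<longleftrightarrow>
     banach_space_of_functions X ev \<and> (\<forall>x\<in>X. continuous_on UNIV (\<lambda>f. ev f x))"

definition point_evaluation :: "('b::banach \<Rightarrow> 'x \<Rightarrow> real) \<Rightarrow> 'x \<Rightarrow> 'b \<Rightarrow>\<^sub>L real" where
  "point_evaluation ev x = Blinfun (\<lambda>f. ev f x)"

definition point_evaluation_span :: "'x set \<Rightarrow> ('b::banach \<Rightarrow> 'x \<Rightarrow> real) \<Rightarrow> ('b \<Rightarrow>\<^sub>L real) set" where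
  "point_evaluation_span X ev = span (point_evaluation ev ` X)"

text \<open>
  A pre-dual is a Banach space \<open>'p\<close> together with the isometric isomorphism \<open>J\<close> identifying
  \<open>'b\<close> with the dual of \<open>'p\<close>.
\<close>

definition predual_via :: "('b::banach \<Rightarrow> ('p::banach \<Rightarrow>\<^sub>L real)) \<Rightarrow> bool" where
  "predual_via J \<longleftrightarrow> linear J \<and> (\<forall>f. norm (J f) = norm f) \<and> surj J"

definition predual_embedding ::
    "('b::banach \<Rightarrow> ('p::banach \<Rightarrow>\<^sub>L real)) \<Rightarrow> 'p \<Rightarrow> 'b \<Rightarrow>\<^sub>L real" where
  "predual_embedding J \<nu> = Blinfun (\<lambda>f. blinfun_apply (J f) \<nu>)"

text \<open>
  \<open>Blinfun\<close> is only meaningful on bounded linear maps; under the intended hypotheses both uses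
  above are such.
\<close>

lemma point_evaluation_apply:
  assumes "rkbs X ev" "x \<in> X"
  shows "blinfun_apply (point_evaluation ev x) f = ev f x"
proof -
  have lin: "linear (\<lambda>f. ev f x)"
    using assms by (auto simp: rkbs_def banach_space_of_functions_def intro!: linearI)
  have "continuous_on UNIV (\<lambda>f. ev f x)"
    using assms by (auto simp: rkbs_def)
  then have "isCont (\<lambda>f. ev f x) 0"
    by (simp add: continuous_on_eq_continuous_at)
  then have "\<exists>d>0. \<forall>f. dist f 0 < d \<longrightarrow> dist (ev f x) (ev 0 x) < 1"
    unfolding continuous_at_eps_delta by (rule allE[of _ 1]) simp
  then obtain d where d: "d > 0" "\<And>f. norm f < d \<Longrightarrow> \<bar>ev f x\<bar> < 1"
    using linear_0[OF lin] by (auto simp: dist_norm)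
  have "bounded_linear (\<lambda>f. ev f x)"
  proof (rule bounded_linear_intro)
    show "ev (f + g) x = ev f x + ev g x" "ev (c *\<^sub>R f) x = c *\<^sub>R ev f x" for f g c
      using linear_add[OF lin] linear_scale[OF lin] by auto
    show "norm (ev f x) \<le> norm f * (2 / d)" for f
    proof (cases "f = 0")
      case True
      then show ?thesis using linear_0[OF lin] by simp
    next
      case False
      define c where "c = d / (2 * norm f)"
      have c: "c > 0" using d(1) False by (simp add: c_def)
      have "norm (c *\<^sub>R f) < d" using d(1) False by (simp add: c_def)
      then have "c * \<bar>ev f x\<bar> < 1"
        using d(2)[of "c *\<^sub>R f"] linear_scale[OF lin, of c f] c by (simp add: abs_mult)
      then show ?thesis using c d(1) False by (simp add: c_def field_simps)
    qed
  qed
  then show ?thesis by (simp add: point_evaluation_def bounded_linear_Blinfun_apply)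
qed

lemma predual_embedding_apply:
  assumes "predual_via J"
  shows "blinfun_apply (predual_embedding J \<nu>) f = blinfun_apply (J f) \<nu>"
proof -
  have lin: "linear J" and iso: "\<And>f. norm (J f) = norm f"
    using assms by (auto simp: predual_via_def)
  have "bounded_linear (\<lambda>f. blinfun_apply (J f) \<nu>)"
  proof (rule bounded_linear_intro)
    show "blinfun_apply (J (f + g)) \<nu> = blinfun_apply (J f) \<nu> + blinfun_apply (J g) \<nu>"
      "blinfun_apply (J (c *\<^sub>R f)) \<nu> = c *\<^sub>R blinfun_apply (J f) \<nu>" for f g c
      using linear_add[OF lin] linear_scale[OF lin]
      by (auto simp: blinfun.add_left blinfun.scaleR_left)
    show "norm (blinfun_apply (J f) \<nu>) \<le> norm f * norm \<nu>" for f
      using norm_blinfun[of "J f" \<nu>] iso[of f] by simp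
  qed
  then show ?thesis by (simp add: predual_embedding_def bounded_linear_Blinfun_apply)
qed

end

theory Submission imports Defs begin

text \<open>
  The proof is an annihilator argument in the pre-dual. Write \<open>E\<close> for the embedding of the
  pre-dual into \<open>\<B>\<^sup>*\<close> and let \<open>D\<close> be the subspace \<open>E\<^sup>-\<^sup>1(\<Delta>)\<close>. A bounded functional on the pre-dual
  is \<open>J f\<close> for some \<open>f\<close>; if it annihilates \<open>D\<close>, then \<open>f\<close> vanishes at each point of \<open>X\<close>, because each
  point evaluation is \<open>E \<nu>\<close> with \<open>\<nu> \<in> D\<close>, and so \<open>f = 0\<close>. By the Hahn-Banach theorem \<open>D\<close> is dense
  in the pre-dual, and by continuity of \<open>E\<close> its image \<open>\<Delta>\<close> is dense in the range of \<open>E\<close>. Conversely,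
  \<open>E\<close> is isometric, again by Hahn-Banach, so its range is complete and hence closed.

  Both uses of Hahn-Banach are instances of \<open>distance_functional\<close>, which yields a functional of
  norm at most one that annihilates a given subspace and attains the distance from a given point
  to it: the subspace \<open>D\<close> gives density, the subspace \<open>{0}\<close> gives isometry. It is derived from the
  dominated form \<open>hahn_banach_dominated\<close>, whose proof applies Zorn's lemma to sublinear
  functionals on the whole space, ordered pointwise, rather than to linear functionals on
  subspaces: the minimal ones turn out to be linear.
\<close>

section \<open>Sublinear functionals\<close>

definition sublinear :: "('a::real_vector \<Rightarrow> real) \<Rightarrow> bool" where
  "sublinear q \<longleftrightarrow>
     (\<forall>x y. q (x + y) \<le> q x + q y) \<and> (\<forall>c x. 0 \<le> c \<longrightarrow> q (c *\<^sub>R x) \<le> c * q x)"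

lemma sublinearI:
  assumes "\<And>x y. q (x + y) \<le> q x + q y" and "\<And>c x. 0 \<le> c \<Longrightarrow> q (c *\<^sub>R x) \<le> c * q x"
  shows "sublinear q"
  using assms by (simp add: sublinear_def)

lemma sublinear_add: "sublinear q \<Longrightarrow> q (x + y) \<le> q x + q y"
  by (simp add: sublinear_def)

lemma sublinear_zero: "sublinear q \<Longrightarrow> q 0 = 0"
  unfolding sublinear_def
  by (metis add_0 add_le_same_cancel1 antisym mult_zero_left order_refl scaleR_zero_left
      le_add_same_cancel1)

lemma sublinear_scaleR:
  assumes "sublinear q" and "0 \<le> c"
  shows "q (c *\<^sub>R x) = c * q x"
proof (cases "c = 0")
  case True
  then show ?thesis using sublinear_zero[OF assms(1)] by simp
next
  case False
  then have c: "0 < c" using assms(2) by simp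
  have "q ((1 / c) *\<^sub>R (c *\<^sub>R x)) \<le> (1 / c) * q (c *\<^sub>R x)"
    using assms(1) c unfolding sublinear_def by (metis less_imp_le zero_le_divide_1_iff)
  then have "c * q x \<le> q (c *\<^sub>R x)"
    using c by (simp add: field_simps)
  moreover have "q (c *\<^sub>R x) \<le> c * q x"
    using assms unfolding sublinear_def by blast
  ultimately show ?thesis by simp
qed

lemma sublinear_minus_le: "sublinear q \<Longrightarrow> - q (- x) \<le> q x"
  using sublinear_add[of q x "- x"] sublinear_zero[of q] by simp

lemma sublinear_odd_imp_linear:
  assumes q: "sublinear q" and odd: "\<And>x. q (- x) = - q x"
  shows "linear q"
proof (rule linearI)
  fix x y
  show "q (x + y) = q x + q y"
    using sublinear_add[OF q, of x y] sublinear_add[OF q, of "- x" "- y"] odd[of "x + y"]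
      odd[of x] odd[of y] by simp
next
  fix c x
  show "q (c *\<^sub>R x) = c *\<^sub>R q x"
  proof (cases "0 \<le> c")
    case True
    then show ?thesis by (simp add: sublinear_scaleR[OF q])
  next
    case False
    then have "q ((- c) *\<^sub>R x) = (- c) * q x"
      by (intro sublinear_scaleR[OF q]) simp
    then show ?thesis using odd[of "c *\<^sub>R x"] by simp
  qed
qed

text \<open>
  The largest sublinear functional below \<open>q\<close> whose value at \<open>- v\<close> is at most \<open>- q v\<close>.
\<close>

definition tilt :: "('a::real_vector \<Rightarrow> real) \<Rightarrow> 'a \<Rightarrow> 'a \<Rightarrow> real" where
  "tilt q v x = (INF t\<in>{0..}. q (x + t *\<^sub>R v) - t * q v)"

lemma tilt_le:
  assumes q: "sublinear q" and "0 \<le> t"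
  shows "tilt q v x \<le> q (x + t *\<^sub>R v) - t * q v"
  unfolding tilt_def
proof (rule cINF_lower)
  show "bdd_below ((\<lambda>t. q (x + t *\<^sub>R v) - t * q v) ` {0..})"
  proof (rule bdd_belowI2)
    fix s :: real assume "s \<in> {0..}"
    then show "- q (- x) \<le> q (x + s *\<^sub>R v) - s * q v"
      using sublinear_add[OF q, of "x + s *\<^sub>R v" "- x"] sublinear_scaleR[OF q, of s v] by simp
  qed
qed (use assms(2) in simp)

lemma tilt_greatest:
  assumes "\<And>t. 0 \<le> t \<Longrightarrow> b \<le> q (x + t *\<^sub>R v) - t * q v"
  shows "b \<le> tilt q v x"
  unfolding tilt_def by (rule cINF_greatest) (use assms in auto)

lemma tilt_le_self: "sublinear q \<Longrightarrow> tilt q v x \<le> q x"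
  using tilt_le[of q 0 v x] by simp

lemma tilt_minus_le: "sublinear q \<Longrightarrow> tilt q v (- v) \<le> - q v"
  using tilt_le[of q 1 v "- v"] by (simp add: sublinear_zero)

lemma sublinear_tilt:
  assumes q: "sublinear q"
  shows "sublinear (tilt q v)"
proof (rule sublinearI)
  fix x y
  have *: "tilt q v (x + y) \<le> (q (x + s *\<^sub>R v) - s * q v) + (q (y + t *\<^sub>R v) - t * q v)"
    if "0 \<le> s" "0 \<le> t" for s t
  proof -
    have "tilt q v (x + y) \<le> q ((x + s *\<^sub>R v) + (y + t *\<^sub>R v)) - (s + t) * q v"
      using tilt_le[OF q, of "s + t" v "x + y"] that by (simp add: algebra_simps)
    then show ?thesis
      using sublinear_add[OF q, of "x + s *\<^sub>R v" "y + t *\<^sub>R v"] by (simp add: algebra_simps)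
  qed
  have "tilt q v (x + y) - (q (x + s *\<^sub>R v) - s * q v) \<le> tilt q v y" if "0 \<le> s" for s
    by (rule tilt_greatest) (use *[OF that] in \<open>smt (verit)\<close>)
  then have "tilt q v (x + y) - tilt q v y \<le> tilt q v x"
    by (intro tilt_greatest) (smt (verit))
  then show "tilt q v (x + y) \<le> tilt q v x + tilt q v y" by simp
next
  fix c :: real and x
  assume c: "0 \<le> c"
  show "tilt q v (c *\<^sub>R x) \<le> c * tilt q v x"
  proof (cases "c = 0")
    case True
    then show ?thesis using tilt_le_self[OF q, of v 0] by (simp add: sublinear_zero[OF q])
  next
    case False
    have "tilt q v (c *\<^sub>R x) / c \<le> tilt q v x"
    proof (rule tilt_greatest)
      fix t :: real assume t: "0 \<le> t"
      have "tilt q v (c *\<^sub>R x) \<le> q (c *\<^sub>R (x + t *\<^sub>R v)) - (c * t) * q v"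
        using tilt_le[OF q, of "c * t" v "c *\<^sub>R x"] c t by (simp add: scaleR_right_distrib)
      also have "\<dots> = c * (q (x + t *\<^sub>R v) - t * q v)"
        by (simp add: sublinear_scaleR[OF q c] right_diff_distrib)
      finally show "tilt q v (c *\<^sub>R x) / c \<le> q (x + t *\<^sub>R v) - t * q v"
        using c False by (simp add: divide_le_eq mult.commute)
    qed
    then show ?thesis using c False by (simp add: divide_le_eq mult.commute)
  qed
qed

text \<open>
  A chain is directed downwards, so two values of the infimum can be tested on one common member,
  to which subadditivity applies. The common upper bound \<open>q\<close> gives the lower bound \<open>- q (- x)\<close>
  that makes the pointwise infimum meaningful.
\<close>

lemma sublinear_chain_Inf:
  assumes ne: "C \<noteq> {}" and sub: "\<And>n. n \<in> C \<Longrightarrow> sublinear n \<and> n \<le> q"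
    and chain: "\<And>n m. n \<in> C \<Longrightarrow> m \<in> C \<Longrightarrow> n \<le> m \<or> m \<le> n"
  defines "u \<equiv> \<lambda>x. INF n\<in>C. n x"
  shows "sublinear u" and "\<And>n. n \<in> C \<Longrightarrow> u \<le> n"
proof -
  have lower: "u x \<le> n x" if "n \<in> C" for n x
    unfolding u_def
  proof (rule cINF_lower)
    show "bdd_below ((\<lambda>n. n x) ` C)"
    proof (rule bdd_belowI2)
      fix m assume "m \<in> C"
      then show "- q (- x) \<le> m x"
        using sub[of m] sublinear_minus_le[of m x] le_funD[of m q "- x"] by simp
    qed
  qed fact
  have greatest: "b \<le> u x" if "\<And>n. n \<in> C \<Longrightarrow> b \<le> n x" for b x
    unfolding u_def by (rule cINF_greatest) (use ne that in auto)
  show "u \<le> n" if "n \<in> C" for n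
    using lower[OF that] by (simp add: le_fun_def)
  show "sublinear u"
  proof (rule sublinearI)
    fix x y
    have *: "u (x + y) \<le> n x + m y" if nm: "n \<in> C" "m \<in> C" for n m
    proof -
      obtain k where k: "k \<in> C" "k \<le> n" "k \<le> m"
        using chain[OF nm] nm by blast
      have "u (x + y) \<le> k (x + y)" by (rule lower[OF k(1)])
      also have "\<dots> \<le> k x + k y" using sub[OF k(1)] sublinear_add by blast
      also have "\<dots> \<le> n x + m y" using k by (auto simp: le_fun_def intro: add_mono)
      finally show ?thesis .
    qed
    have "u (x + y) - n x \<le> u y" if "n \<in> C" for n
      by (rule greatest) (use *[OF that] in \<open>smt (verit)\<close>)
    then have "u (x + y) - u y \<le> u x"
      by (intro greatest) (smt (verit))
    then show "u (x + y) \<le> u x + u y" by simp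
  next
    fix c :: real and x
    assume c: "0 \<le> c"
    have *: "u (c *\<^sub>R x) \<le> c * n x" if "n \<in> C" for n
      using lower[OF that, of "c *\<^sub>R x"] sub[OF that] sublinear_scaleR[of n c x] c by simp
    show "u (c *\<^sub>R x) \<le> c * u x"
    proof (cases "c = 0")
      case True
      then show ?thesis using * ne by auto
    next
      case False
      have "u (c *\<^sub>R x) / c \<le> u x"
        by (rule greatest) (use * c False in \<open>simp add: divide_le_eq mult.commute\<close>)
      then show ?thesis using c False by (simp add: divide_le_eq mult.commute)
    qed
  qed
qed

section \<open>The Hahn-Banach theorem\<close>

text \<open>
  Zorn's lemma gives a minimal sublinear functional, since chains have infima. Minimality against
  every tilt makes it odd, and an odd sublinear functional is linear.
\<close>

lemma linear_below_sublinear: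
  assumes q: "sublinear q"
  shows "\<exists>\<phi>. linear \<phi> \<and> \<phi> \<le> q"
proof -
  define A where "A = {n. sublinear n \<and> n \<le> q}"
  define P where "P = (\<lambda>n m :: 'a \<Rightarrow> real. m \<le> n)"
  have "\<exists>m\<in>A. \<forall>n\<in>A. P m n \<longrightarrow> n = m"
  proof (rule predicate_Zorn)
    show "partial_order_on A (relation_of P A)"
      unfolding P_def by (rule partial_order_on_relation_ofI) auto
  next
    fix C assume C: "C \<in> Chains (relation_of P A)"
    have CA: "n \<in> A" if "n \<in> C" for n
      using C that by (auto simp: Chains_def relation_of_def)
    have chain: "n \<le> m \<or> m \<le> n" if "n \<in> C" "m \<in> C" for n m
      using C that by (auto simp: Chains_def relation_of_def P_def)
    show "\<exists>u\<in>A. \<forall>n\<in>C. P n u"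
    proof (cases "C = {}")
      case True
      then show ?thesis using q by (auto simp: A_def)
    next
      case False
      define u where "u = (\<lambda>x. INF n\<in>C. n x)"
      have sub: "sublinear n \<and> n \<le> q" if "n \<in> C" for n
        using CA[OF that] by (simp add: A_def)
      have "sublinear u" and below: "u \<le> n" if "n \<in> C" for n
        unfolding u_def
        using sublinear_chain_Inf[of C q, OF False sub chain] that by simp_all
      moreover have "u \<le> q"
        using False below sub by (blast intro: order_trans)
      ultimately show ?thesis
        using False below unfolding A_def P_def by blast
    qed
  qed
  then obtain m where m: "sublinear m" "m \<le> q"
    and min: "\<And>n. sublinear n \<Longrightarrow> n \<le> m \<Longrightarrow> n = m"
    unfolding A_def P_def by (blast intro: order_trans)
  have "m (- v) = - m v" for v
  proof -
    have "tilt m v = m"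
      using min[OF sublinear_tilt[OF m(1)]] tilt_le_self[OF m(1)] by (simp add: le_fun_def)
    then have "m (- v) \<le> - m v"
      using tilt_minus_le[OF m(1), of v] by simp
    then show ?thesis
      using sublinear_minus_le[OF m(1), of v] by simp
  qed
  then show ?thesis
    using sublinear_odd_imp_linear[OF m(1)] m(2) by blast
qed

text \<open>
  A linear functional below \<open>tilt q v\<close> satisfies \<open>\<phi> (- v) \<le> - q v\<close>, which is the missing
  inequality \<open>q v \<le> \<phi> v\<close>.
\<close>

lemma hahn_banach_dominated:
  assumes q: "sublinear q"
  shows "\<exists>\<phi>. linear \<phi> \<and> \<phi> \<le> q \<and> \<phi> v = q v"
proof -
  obtain \<phi> where lin: "linear \<phi>" and le: "\<phi> \<le> tilt q v"
    using linear_below_sublinear[OF sublinear_tilt[OF q]] by blast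
  have le_q: "\<phi> x \<le> q x" for x
    using le tilt_le_self[OF q, of v x] by (auto simp: le_fun_def intro: order_trans)
  have "\<phi> (- v) \<le> - q v"
    using le tilt_minus_le[OF q, of v] by (auto simp: le_fun_def intro: order_trans)
  then have "q v \<le> \<phi> v"
    by (simp add: linear_neg[OF lin])
  then show ?thesis
    using lin le_q by (auto simp: le_fun_def intro: antisym)
qed

lemma sublinear_infdist:
  fixes M :: "'a::real_normed_vector set"
  assumes M: "subspace M"
  shows "sublinear (\<lambda>x. infdist x M)"
proof -
  have ne: "M \<noteq> {}" using subspace_0[OF M] by blast
  have greatest: "b \<le> infdist x M" if "\<And>a. a \<in> M \<Longrightarrow> b \<le> norm (x - a)" for b x
    unfolding infdist_notempty[OF ne] dist_norm by (rule cINF_greatest) (use ne that in auto)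
  have lower: "infdist x M \<le> norm (x - a)" if "a \<in> M" for a x
    using infdist_le[OF that, of x] by (simp add: dist_norm)
  show ?thesis
  proof (rule sublinearI)
    fix x y
    have *: "infdist (x + y) M \<le> norm (x - a) + norm (y - b)" if "a \<in> M" "b \<in> M" for a b
    proof -
      have "infdist (x + y) M \<le> norm ((x - a) + (y - b))"
        using lower[OF subspace_add[OF M that], of "x + y"] by (simp add: algebra_simps)
      then show ?thesis using norm_triangle_ineq[of "x - a" "y - b"] by simp
    qed
    have "infdist (x + y) M - norm (x - a) \<le> infdist y M" if "a \<in> M" for a
      by (rule greatest) (use *[OF that] in \<open>smt (verit)\<close>)
    then have "infdist (x + y) M - infdist y M \<le> infdist x M"
      by (intro greatest) (smt (verit))
    then show "infdist (x + y) M \<le> infdist x M + infdist y M" by simp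
  next
    fix c :: real and x
    assume c: "0 \<le> c"
    have *: "infdist (c *\<^sub>R x) M \<le> c * norm (x - a)" if "a \<in> M" for a
      using lower[OF subspace_scale[OF M that, of c], of "c *\<^sub>R x"] c
      by (simp flip: scaleR_diff_right)
    show "infdist (c *\<^sub>R x) M \<le> c * infdist x M"
    proof (cases "c = 0")
      case True
      then show ?thesis using * ne by auto
    next
      case False
      have "infdist (c *\<^sub>R x) M / c \<le> infdist x M"
        by (rule greatest) (use * c False in \<open>simp add: divide_le_eq mult.commute\<close>)
      then show ?thesis using c False by (simp add: divide_le_eq mult.commute)
    qed
  qed
qed

text \<open>
  The distance to \<open>M\<close> is sublinear, at most the norm, and zero on \<open>M\<close>. A linear functional
  dominated by it inherits the norm bound and the vanishing on \<open>M\<close>, since the domination applies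
  to both \<open>x\<close> and \<open>- x\<close>.
\<close>

lemma distance_functional:
  fixes M :: "'a::real_normed_vector set"
  assumes M: "subspace M"
  shows "\<exists>\<phi> :: 'a \<Rightarrow>\<^sub>L real. norm \<phi> \<le> 1 \<and> (\<forall>x\<in>M. blinfun_apply \<phi> x = 0) \<and>
    blinfun_apply \<phi> v = infdist v M"
proof -
  obtain \<phi> where lin: "linear \<phi>" and le: "\<And>x. \<phi> x \<le> infdist x M" and v: "\<phi> v = infdist v M"
    using hahn_banach_dominated[OF sublinear_infdist[OF M], of v] by (auto simp: le_fun_def)
  have "infdist x M \<le> norm x" for x
    using infdist_le[OF subspace_0[OF M], of x] by simp
  then have bound: "\<bar>\<phi> x\<bar> \<le> norm x" for x
    using le[of x] le[of "- x"] linear_neg[OF lin, of x] norm_minus_cancel[of x]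
    by (smt (verit))
  have zero: "\<phi> x = 0" if "x \<in> M" for x
    using le[of x] le[of "- x"] linear_neg[OF lin, of x] that subspace_neg[OF M that] by simp
  have "bounded_linear \<phi>"
    by (rule bounded_linear_intro[of _ 1])
      (use lin bound in \<open>auto simp: linear_add linear_scale\<close>)
  then have app: "blinfun_apply (Blinfun \<phi>) = \<phi>"
    by (rule bounded_linear_Blinfun_apply)
  have "norm (Blinfun \<phi>) \<le> 1"
    by (rule norm_blinfun_bound) (use bound in \<open>auto simp: app\<close>)
  then show ?thesis
    using zero v by (intro exI[of _ "Blinfun \<phi>"]) (simp add: app)
qed

section \<open>The embedding of the pre-dual\<close>

lemma linear_predual_embedding:
  assumes "predual_via J"
  shows "linear (predual_embedding J)"
  by (rule linearI; rule blinfun_eqI)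
    (simp_all add: predual_embedding_apply[OF assms] blinfun.add_left blinfun.add_right
      blinfun.scaleR_left blinfun.scaleR_right)

text \<open>
  A functional on the pre-dual of norm at most one that attains \<open>norm \<nu>\<close> has the form \<open>J f\<close> with
  \<open>norm f \<le> 1\<close>, so the norm of the image of \<open>\<nu>\<close> is attained as well.
\<close>

lemma norm_predual_embedding:
  assumes J: "predual_via J"
  shows "norm (predual_embedding J \<nu>) = norm \<nu>"
proof (rule antisym)
  show "norm (predual_embedding J \<nu>) \<le> norm \<nu>"
  proof (rule norm_blinfun_bound)
    fix f
    show "norm (predual_embedding J \<nu> f) \<le> norm \<nu> * norm f"
      using norm_blinfun[of "J f" \<nu>] J
      by (simp add: predual_embedding_apply[OF J] predual_via_def mult.commute)
  qed simp
next
  obtain \<phi> :: "'b \<Rightarrow>\<^sub>L real" where \<phi>: "norm \<phi> \<le> 1" "\<phi> \<nu> = norm \<nu>"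
    using distance_functional[OF subspace_single_0, of \<nu>] by auto
  obtain f where f: "\<phi> = J f" using J unfolding predual_via_def by (metis surjD)
  have "norm \<nu> = predual_embedding J \<nu> f"
    using \<phi> f by (simp add: predual_embedding_apply[OF J])
  also have "\<dots> \<le> norm (predual_embedding J \<nu>) * norm f"
    using norm_blinfun[of "predual_embedding J \<nu>" f] by simp
  also have "\<dots> \<le> norm (predual_embedding J \<nu>)"
    using J \<phi>(1) f by (simp add: predual_via_def mult_left_le)
  finally show "norm \<nu> \<le> norm (predual_embedding J \<nu>)" .
qed

lemma bounded_linear_predual_embedding:
  assumes "predual_via J"
  shows "bounded_linear (predual_embedding J)"
  using linear_predual_embedding[OF assms] norm_predual_embedding[OF assms]
  by (intro bounded_linear_intro[of _ 1]) (auto simp: linear_add linear_scale)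

lemma closed_range_predual_embedding:
  assumes "predual_via J"
  shows "closed (range (predual_embedding J))"
  using complete_isometric_image[OF zero_less_one subspace_UNIV
      bounded_linear_predual_embedding[OF assms]]
  by (simp add: norm_predual_embedding[OF assms] complete_UNIV complete_imp_closed)

section \<open>Density of the point evaluations\<close>

theorem proposition3:
  fixes X :: "'x set"
    and ev :: "'b::banach \<Rightarrow> 'x \<Rightarrow> real"
    and J :: "'b \<Rightarrow> ('p::banach \<Rightarrow>\<^sub>L real)"
  assumes "rkbs X ev"
    and "predual_via J"
    and "point_evaluation_span X ev \<subseteq> range (predual_embedding J)"
  shows "closure (point_evaluation_span X ev) = range (predual_embedding J)"
proof
  show "closure (point_evaluation_span X ev) \<subseteq> range (predual_embedding J)"
    by (rule closure_minimal[OF assms(3) closed_range_predual_embedding[OF assms(2)]])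
next
  let ?E = "predual_embedding J"
  define D where "D = ?E -` point_evaluation_span X ev"
  have D: "subspace D"
    unfolding D_def point_evaluation_span_def
    by (intro linear_subspace_vimage linear_predual_embedding assms(2) subspace_span)
  have dense: "\<nu> \<in> closure D" for \<nu>
  proof -
    obtain \<phi> :: "'p \<Rightarrow>\<^sub>L real" where \<phi>: "\<forall>\<mu>\<in>D. \<phi> \<mu> = 0" "\<phi> \<nu> = infdist \<nu> D"
      using distance_functional[OF D] by blast
    obtain f where f: "\<phi> = J f"
      using assms(2) unfolding predual_via_def by (metis surjD)
    have "ev f x = ev 0 x" if x: "x \<in> X" for x
    proof -
      have mem: "point_evaluation ev x \<in> point_evaluation_span X ev"
        unfolding point_evaluation_span_def using x by (intro span_base) simp
      then obtain \<mu> where \<mu>: "?E \<mu> = point_evaluation ev x"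
        using assms(3) by (metis imageE subsetD)
      then have "\<mu> \<in> D" using mem by (simp add: D_def)
      then have "?E \<mu> f = 0"
        using \<phi>(1) f by (simp add: predual_embedding_apply[OF assms(2)])
      then show ?thesis
        using \<mu> point_evaluation_apply[OF assms(1) x, of f]
          point_evaluation_apply[OF assms(1) x, of 0] by simp
    qed
    then have "restrict (ev f) X = restrict (ev 0) X" by auto
    then have "f = 0"
      using assms(1) by (auto simp: rkbs_def banach_space_of_functions_def dest: injD)
    then have "infdist \<nu> D = 0"
      using \<phi>(2) f assms(2) by (simp add: predual_via_def linear_0)
    then show ?thesis
      using subspace_0[OF D] in_closure_iff_infdist_zero[of D \<nu>] by blast
  qed
  have "?E ` closure D \<subseteq> closure (point_evaluation_span X ev)"
  proof (rule image_closure_subset)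
    show "continuous_on (closure D) ?E"
      by (rule linear_continuous_on[OF bounded_linear_predual_embedding[OF assms(2)]])
    show "?E ` D \<subseteq> closure (point_evaluation_span X ev)"
      using closure_subset by (auto simp: D_def)
  qed simp
  then show "range ?E \<subseteq> closure (point_evaluation_span X ev)"
    using dense by blast
qed

end
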